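(* Let $B\in\mathbb R^{d\times r}$, and let $A\in\mathbb Z^{s\times r}$ have full row rank and satisfy $\ker A=\ker B$. If $0<s<r$, let $\Delta(A)$ be the largest absolute value of an $s\times s$ minor of $A$. Then $$\kappa(B)\le\Delta(A).$$ If $\ker B=\{0\}$ or $\ker B=\mathbb R^r$, then $\kappa(B)=1$. In particular, if $B$ is totally unimodular, then $\kappa(B)=1$.
   Context: For a matrix $B$ with $r$ columns and $k\in\mathbb Z_{>0}^r$, $L_k(B)=\operatorname{span}\{z\in\ker B\cap\mathbb Z^r:|z_t|\le k_t\text{ for every }t\}$ (real linear span). When $\ker B$ is rational (has a basis of rational vectors; the zero subspace is rational), the uniform replication threshold is $\kappa(B)=\min\{k\in\mathbb Z_{>0}:L_{k\mathbf 1}(B)=\ker B\}$, where $\mathbf 1\in\mathbb R^r$ is the all-ones vector; this minimum exists for rational kernels. *)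

theory Defs
  imports
    "Jordan_Normal_Form.Matrix_Kernel"
    "Jordan_Normal_Form.DL_Rank"
    "Jordan_Normal_Form.DL_Submatrix"
begin

abbreviation real_span :: "nat \<Rightarrow> real vec set \<Rightarrow> real vec set" where
  "real_span r S \<equiv> LinearCombinations.module.span class_ring (module_vec TYPE(real) r) S"

definition bounded_kernel_span :: "real mat \<Rightarrow> nat vec \<Rightarrow> real vec set" where
  "bounded_kernel_span B k = real_span (dim_col B)
     {z \<in> mat_kernel B. \<forall>t < dim_col B. z $ t \<in> \<int> \<and> \<bar>z $ t\<bar> \<le> real (k $ t)}"

(* The minimum exists exactly when the kernel of B has a basis of rational vectors;
   for any other B the value is unspecified. *)
definition replication_threshold :: "real mat \<Rightarrow> nat" where
  "replication_threshold B =
     (LEAST k. 0 < k \<and> bounded_kernel_span B (vec (dim_col B) (\<lambda>_. k)) = mat_kernel B)"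

definition minors :: "nat \<Rightarrow> 'a :: comm_ring_1 mat \<Rightarrow> 'a set" where
  "minors m A = {det (submatrix A I J) | I J.
     I \<subseteq> {..<dim_row A} \<and> J \<subseteq> {..<dim_col A} \<and> card I = m \<and> card J = m}"

definition totally_unimodular :: "real mat \<Rightarrow> bool" where
  "totally_unimodular B \<longleftrightarrow> (\<forall>m. minors m B \<subseteq> {-1, 0, 1})"

definition full_row_rank :: "int mat \<Rightarrow> bool" where
  "full_row_rank A \<longleftrightarrow>
     vec_space.rank (dim_row A) (map_mat real_of_int A) = dim_row A"

(* Meaningful only if dim_row A \<le> dim_col A; otherwise A has no minor of order dim_row A. *)
definition max_abs_minor :: "int mat \<Rightarrow> int" where
  "max_abs_minor A = Max (abs ` minors (dim_row A) A)"

end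

theory Submission imports Defs
begin

text \<open>
The kernel of a matrix \<open>M\<close> of rank \<open>m\<close> is spanned by the vectors that Cramer's rule produces, and the
entries of these vectors are, up to sign, minors of order \<open>m\<close>. So if all minors of order \<open>m\<close> are
integers of absolute value at most \<open>k\<close>, the integral kernel vectors with entries of absolute value at
most \<open>k\<close> already span the kernel.

In detail, fix rows \<open>g 0, ..., g (m - 1)\<close> and columns \<open>f 0, ..., f (m - 1)\<close> such that the selected
submatrix has determinant \<open>D \<noteq> 0\<close>, and assume that every minor of order \<open>m + 1\<close> vanishes. Bordering
the selected submatrix by a row \<open>i\<close> and a column \<open>j\<close> gives a singular matrix; a vector in the kernel of
the bordered matrix expresses column \<open>j\<close> through the columns \<open>f k\<close>, and by Cramer's rule
\<open>D M\<^sub>i\<^sub>j = (\<Sum>k<m. M\<^sub>i\<^sub>,\<^sub>f\<^sub>k D\<^sub>k\<^sub>j)\<close>, where \<open>D\<^sub>k\<^sub>j\<close> arises from \<open>D\<close> by putting column \<open>j\<close> in place of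
column \<open>f k\<close> (\<open>column_relation\<close>). Hence the vector with entry \<open>D\<close> at \<open>j\<close> and \<open>- D\<^sub>k\<^sub>j\<close> at \<open>f k\<close> lies
in the kernel (\<open>cramer_vec_in_kernel\<close>). For \<open>j\<close> running through the columns outside the range of \<open>f\<close>,
these vectors span it, because a kernel vector is determined by its entries outside the range of \<open>f\<close>
(\<open>kernel_vec_as_cramer_combination\<close>).

The case of an integer matrix \<open>A\<close> of full row rank \<open>s\<close> takes \<open>m = s\<close>: some minor of order \<open>s\<close> is
nonzero, there are no larger ones, and \<open>k\<close> is the largest absolute value of a minor. For a totally
unimodular matrix, \<open>m\<close> is the largest order of a nonzero minor and \<open>k = 1\<close>. When the kernel is zero or everything,
the zero vector or the unit vectors span it.
\<close>

section \<open>Determinants of selected rows and columns\<close>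

text \<open>A \<open>submatrix\<close> lists rows and columns in increasing order. Replacing one column by
another breaks that order, so the computations use arbitrary enumerations of rows and columns, with
repetitions permitted, and return to minors only at the end.\<close>

definition select :: "nat \<Rightarrow> 'a mat \<Rightarrow> (nat \<Rightarrow> nat) \<Rightarrow> (nat \<Rightarrow> nat) \<Rightarrow> 'a mat" where
  "select m A g f = mat m m (\<lambda>(i, j). A $$ (g i, f j))"

lemma select_carrier [simp]: "select m A g f \<in> carrier_mat m m"
  by (simp add: select_def)

lemma transpose_select:
  assumes "g ` {..<m} \<subseteq> {..<dim_row A}" "f ` {..<m} \<subseteq> {..<dim_col A}"
  shows "transpose_mat (select m A g f) = select m (transpose_mat A) f g"
  using assms by (intro eq_matI) (auto simp: select_def image_subset_iff)

lemma pick_image: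
  fixes g :: "nat \<Rightarrow> nat"
  assumes "inj_on g {..<m}"
  shows "pick (g ` {..<m}) ` {..<m} \<subseteq> g ` {..<m}"
  using assms by (intro image_subsetI pick_in_set_le) (simp add: card_image)

text \<open>An injective enumeration of rows differs from the increasing one by a permutation, which
changes the determinant only by its sign.\<close>

lemma det_select_sort_rows:
  fixes A :: "'a :: comm_ring_1 mat"
  assumes inj: "inj_on g {..<m}"
  shows "det (select m A g f) \<in> {det (select m A (pick (g ` {..<m})) f), - det (select m A (pick (g ` {..<m})) f)}"
proof -
  let ?I = "g ` {..<m}"
  \<comment> \<open>\<open>p i\<close> is the position of \<open>g i\<close> among the selected rows; outside \<open>{..<m}\<close> it must be the identity for
    \<open>p\<close> to be a permutation.\<close>
  define p where "p i = (if i < m then card {a \<in> ?I. a < g i} else i)" for i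
  have pick_p: "pick ?I (p i) = g i" if "i < m" for i
    using that by (simp add: p_def pick_card_in_set)
  have p_less: "p i < m" if "i < m" for i
  proof -
    have "{a \<in> ?I. a < g i} \<subset> ?I" using that by auto
    then have "card {a \<in> ?I. a < g i} < card ?I" by (intro psubset_card_mono) auto
    then show ?thesis using that inj by (simp add: p_def card_image)
  qed
  have "inj_on p {..<m}"
  proof (rule inj_onI)
    fix i j assume ij: "i \<in> {..<m}" "j \<in> {..<m}" "p i = p j"
    then have "g i = g j" using pick_p[of i] pick_p[of j] by simp
    then show "i = j" using inj ij by (auto dest: inj_onD)
  qed
  then have "bij_betw p {..<m} {..<m}"
    using p_less by (intro bij_betw_imageI endo_inj_surj) auto
  then have p: "p permutes {0..<m}"
    by (intro bij_imp_permutes) (auto simp: p_def atLeast0LessThan)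
  have "select m A g f = mat m m (\<lambda>(i, j). select m A (pick ?I) f $$ (p i, j))"
    by (intro eq_matI) (auto simp: select_def pick_p p_less)
  then have "det (select m A g f) = signof p * det (select m A (pick ?I) f)"
    using det_permute_rows[OF select_carrier p, of A "pick ?I" f] by simp
  then show ?thesis by (auto simp: sign_def)
qed

lemma det_select_sort_cols:
  fixes A :: "'a :: comm_ring_1 mat"
  assumes inj: "inj_on f {..<m}"
    and sub: "g ` {..<m} \<subseteq> {..<dim_row A}" "f ` {..<m} \<subseteq> {..<dim_col A}"
  shows "det (select m A g f) \<in> {det (select m A g (pick (f ` {..<m}))), - det (select m A g (pick (f ` {..<m})))}"
proof -
  have "pick (f ` {..<m}) ` {..<m} \<subseteq> {..<dim_col A}"
    using pick_image[OF inj] sub by blast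
  then show ?thesis
    using det_select_sort_rows[OF inj, of "transpose_mat A" g] sub
    by (simp add: transpose_select[symmetric] det_transpose[OF select_carrier])
qed

lemma submatrix_eq_select:
  assumes "I \<subseteq> {..<dim_row A}" "J \<subseteq> {..<dim_col A}" "card I = m" "card J = m"
  shows "submatrix A I J = select m A (pick I) (pick J)"
proof -
  have "{i. i < dim_row A \<and> i \<in> I} = I" "{i. i < dim_col A \<and> i \<in> J} = J"
    using assms by auto
  then show ?thesis using assms by (simp add: submatrix_def select_def)
qed

text \<open>If the enumerations are injective, sorting turns the selection into a submatrix; otherwise
two rows or two columns of it coincide.\<close>

lemma det_select_zero_or_minor:
  fixes A :: "'a :: comm_ring_1 mat"
  assumes sub: "g ` {..<m} \<subseteq> {..<dim_row A}" "f ` {..<m} \<subseteq> {..<dim_col A}"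
  shows "det (select m A g f) = 0 \<or> det (select m A g f) \<in> minors m A \<or> - det (select m A g f) \<in> minors m A"
proof (cases "inj_on g {..<m} \<and> inj_on f {..<m}")
  case True
  let ?I = "g ` {..<m}" and ?J = "f ` {..<m}"
  have "det (select m A (pick ?I) (pick ?J)) \<in> minors m A"
    unfolding minors_def mem_Collect_eq using sub True
    by (intro exI[of _ ?I] exI[of _ ?J]) (simp add: card_image submatrix_eq_select)
  moreover have "pick ?I ` {..<m} \<subseteq> {..<dim_row A}"
    using pick_image True sub by blast
  ultimately show ?thesis
    using det_select_sort_rows[of g m A f] det_select_sort_cols[of f m "pick ?I" A] sub(2) True
    by auto
next
  case False
  then consider i j where "i < m" "j < m" "i \<noteq> j" "g i = g j"
    | i j where "i < m" "j < m" "i \<noteq> j" "f i = f j"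
    by (auto simp: inj_on_def)
  then have "det (select m A g f) = 0"
  proof cases
    case 1
    then have "row (select m A g f) i = row (select m A g f) j"
      by (auto simp: select_def)
    then show ?thesis using 1 det_identical_rows[OF select_carrier] by blast
  next
    case 2
    then have "col (select m A g f) i = col (select m A g f) j"
      by (auto simp: select_def)
    then show ?thesis using 2 det_identical_columns[OF select_carrier] by blast
  qed
  then show ?thesis by simp
qed

lemma minor_as_select:
  assumes "\<mu> \<in> minors m A"
  obtains g f where "g ` {..<m} \<subseteq> {..<dim_row A}" "f ` {..<m} \<subseteq> {..<dim_col A}"
    "inj_on f {..<m}" "\<mu> = det (select m A g f)"
proof -
  obtain I J where IJ: "I \<subseteq> {..<dim_row A}" "J \<subseteq> {..<dim_col A}" "card I = m" "card J = m"
    and \<mu>: "\<mu> = det (submatrix A I J)"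
    using assms unfolding minors_def by blast
  show thesis
  proof
    show "pick I ` {..<m} \<subseteq> {..<dim_row A}" "pick J ` {..<m} \<subseteq> {..<dim_col A}"
      using IJ pick_in_set_le[of _ I] pick_in_set_le[of _ J] by (auto simp: image_subset_iff)
    show "inj_on (pick J) {..<m}"
    proof (rule inj_onI)
      fix i j assume "i \<in> {..<m}" "j \<in> {..<m}" "pick J i = pick J j"
      then show "i = j"
        using pick_mono_le[of i J j] pick_mono_le[of j J i] IJ(4) by (cases i j rule: linorder_cases) auto
    qed
    show "\<mu> = det (select m A (pick I) (pick J))"
      using \<mu> IJ by (simp add: submatrix_eq_select)
  qed
qed

section \<open>Kernel vectors from Cramer's rule\<close>

lemma mult_mat_vec_index_sum:
  assumes "M \<in> carrier_mat d r" "x \<in> carrier_vec r" "i < d"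
  shows "(M *\<^sub>v x) $ i = (\<Sum>t<r. M $$ (i, t) * x $ t)"
  using assms by (simp add: scalar_prod_def atLeast0LessThan)

lemma select_mult_vec_index:
  assumes "x \<in> carrier_vec m" "l < m"
  shows "(select m M g f *\<^sub>v x) $ l = (\<Sum>k<m. M $$ (g l, f k) * x $ k)"
  using mult_mat_vec_index_sum[OF select_carrier assms, of M g f] assms(2)
  by (simp add: select_def)

text \<open>Every column is a combination of the columns selected by \<open>f\<close>, with the coefficients of Cramer's
rule. They are computed from the rows selected by \<open>g\<close> alone; they are correct in every other row \<open>i\<close>
since the matrix bordered by row \<open>i\<close> and column \<open>j\<close> is singular.\<close>

lemma column_relation:
  fixes M :: "'a :: field mat"
  assumes M: "M \<in> carrier_mat d r"
    and g: "g ` {..<m} \<subseteq> {..<d}" and f: "f ` {..<m} \<subseteq> {..<r}"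
    and nz: "det (select m M g f) \<noteq> 0"
    and van: "minors (Suc m) M \<subseteq> {0}"
    and i: "i < d" and j: "j < r"
  shows "det (select m M g f) * M $$ (i, j)
    = (\<Sum>k<m. M $$ (i, f k) * det (select m M g (f(k := j))))"
proof -
  let ?N = "select m M g f"
  let ?P = "select (Suc m) M (g(m := i)) (f(m := j))"
  have "det ?P = 0"
  proof -
    have "(g(m := i)) ` {..<Suc m} \<subseteq> {..<dim_row M}" "(f(m := j)) ` {..<Suc m} \<subseteq> {..<dim_col M}"
      using M g f i j by (auto simp: image_subset_iff)
    from det_select_zero_or_minor[OF this] have "det ?P \<in> {0} \<or> - det ?P \<in> {0}"
      using van by blast
    then show ?thesis by simp
  qed
  then obtain v where v: "v \<in> carrier_vec (Suc m)" "v \<noteq> 0\<^sub>v (Suc m)" "?P *\<^sub>v v = 0\<^sub>v (Suc m)"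
    using det_0_iff_vec_prod_zero_field[OF select_carrier[of "Suc m"]] by blast
  have row_g: "(\<Sum>k<m. M $$ (g l, f k) * v $ k) + M $$ (g l, j) * v $ m = 0" if "l < m" for l
  proof -
    have "(?P *\<^sub>v v) $ l = 0" using v that by simp
    then show ?thesis
      using select_mult_vec_index[OF v(1), of l M "g(m := i)" "f(m := j)"] that by simp
  qed
  have row_i: "(\<Sum>k<m. M $$ (i, f k) * v $ k) + M $$ (i, j) * v $ m = 0"
  proof -
    have "(?P *\<^sub>v v) $ m = 0" using v by simp
    then show ?thesis
      using select_mult_vec_index[OF v(1), of m M "g(m := i)" "f(m := j)"] by simp
  qed
  \<comment> \<open>If \<open>v $ m\<close> vanished, the other entries of \<open>v\<close> would be a dependency of the columns of \<open>?N\<close>.\<close>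
  have vm: "v $ m \<noteq> 0"
  proof
    assume 0: "v $ m = 0"
    have "?N *\<^sub>v vec m (($) v) = 0\<^sub>v m"
    proof (rule eq_vecI)
      fix l assume "l < dim_vec (0\<^sub>v m :: 'a vec)"
      then have l: "l < m" by simp
      show "(?N *\<^sub>v vec m (($) v)) $ l = 0\<^sub>v m $ l"
        using row_g[OF l] 0 l select_mult_vec_index[of "vec m (($) v)" m l M g f] by simp
    qed (simp add: select_def)
    then have "vec m (($) v) = 0\<^sub>v m"
      using nz det_0_iff_vec_prod_zero_field[OF select_carrier[of m M g f]] vec_carrier by blast
    then have "v $ k = 0" if "k < m" for k using that by (metis index_vec index_zero_vec(1))
    then have "v = 0\<^sub>v (Suc m)"
      using v(1) 0 by (intro eq_vecI) (auto simp: less_Suc_eq)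
    then show False using v by simp
  qed
  \<comment> \<open>Solve the dependency \<open>v\<close> for the border column.\<close>
  define c where "c = vec m (\<lambda>k. - v $ k / v $ m)"
  have c: "c \<in> carrier_vec m" by (simp add: c_def)
  have combine: "(\<Sum>k<m. a k * c $ k) = b" if "(\<Sum>k<m. a k * v $ k) + b * v $ m = 0" for a b
  proof -
    have "(\<Sum>k<m. a k * c $ k) = - (\<Sum>k<m. a k * v $ k) / v $ m"
      by (simp add: c_def sum_negf sum_divide_distrib)
    also have "- (\<Sum>k<m. a k * v $ k) = b * v $ m" using that by (simp add: add_eq_0_iff)
    also have "b * v $ m / v $ m = b" using vm by simp
    finally show ?thesis .
  qed
  have Nc: "?N *\<^sub>v c = vec m (\<lambda>l. M $$ (g l, j))"
  proof (rule eq_vecI)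
    fix l assume "l < dim_vec (vec m (\<lambda>l. M $$ (g l, j)))"
    then have l: "l < m" by simp
    show "(?N *\<^sub>v c) $ l = vec m (\<lambda>l. M $$ (g l, j)) $ l"
      using combine[OF row_g[OF l]] l select_mult_vec_index[OF c l, of M g f] by simp
  qed (simp add: select_def)
  have cramer: "det (select m M g (f(k := j))) = c $ k * det ?N" if k: "k < m" for k
  proof -
    have "replace_col ?N (?N *\<^sub>v c) k = select m M g (f(k := j))"
      unfolding Nc by (intro eq_matI) (auto simp: replace_col_def select_def)
    then show ?thesis using cramer_lemma_mat[OF select_carrier c k, of M g f] by simp
  qed
  have "(\<Sum>k<m. M $$ (i, f k) * det (select m M g (f(k := j))))
      = (\<Sum>k<m. M $$ (i, f k) * c $ k) * det ?N"
    by (simp add: cramer sum_distrib_right mult.assoc)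
  also have "\<dots> = det ?N * M $$ (i, j)"
    using combine[OF row_i] by simp
  finally show ?thesis by simp
qed

text \<open>For \<open>f\<close> injective and \<open>j\<close> outside its range, this is the Cramer relation expressing column \<open>j\<close>
through the columns \<open>f k\<close>, cleared of denominators. Indexing by the column \<open>t = f k\<close> instead of \<open>k\<close>
makes every entry visibly zero or, up to sign, the determinant of a selection.\<close>

definition cramer_vec :: "nat \<Rightarrow> 'a :: comm_ring_1 mat \<Rightarrow> (nat \<Rightarrow> nat) \<Rightarrow> (nat \<Rightarrow> nat) \<Rightarrow> nat \<Rightarrow> 'a vec" where
  "cramer_vec m M g f j = vec (dim_col M) (\<lambda>t.
     if t = j then det (select m M g f)
     else if t \<in> f ` {..<m} then - det (select m M g (\<lambda>k. if f k = t then j else f k))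
     else 0)"

lemma sum_split_image:
  fixes h :: "nat \<Rightarrow> 'a :: comm_monoid_add"
  assumes "inj_on f {..<m}" "f ` {..<m} \<subseteq> {..<r}"
  shows "(\<Sum>t<r. h t) = (\<Sum>t\<in>{..<r} - f ` {..<m}. h t) + (\<Sum>k<m. h (f k))"
  using sum.subset_diff[OF assms(2), of h] sum.reindex[OF assms(1), of h]
  by (simp add: o_def)

lemma cramer_vec_in_kernel:
  fixes M :: "'a :: field mat"
  assumes M: "M \<in> carrier_mat d r"
    and g: "g ` {..<m} \<subseteq> {..<d}" and f: "f ` {..<m} \<subseteq> {..<r}" and inj: "inj_on f {..<m}"
    and nz: "det (select m M g f) \<noteq> 0"
    and van: "minors (Suc m) M \<subseteq> {0}"
    and j: "j < r" "j \<notin> f ` {..<m}"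
  shows "cramer_vec m M g f j \<in> mat_kernel M"
proof (rule mat_kernelI[OF M])
  let ?w = "cramer_vec m M g f j"
  show w: "?w \<in> carrier_vec r" using M by (simp add: cramer_vec_def)
  have w_f: "?w $ f k = - det (select m M g (f(k := j)))" if "k < m" for k
  proof -
    have "select m M g (\<lambda>l. if f l = f k then j else f l) = select m M g (f(k := j))"
      using inj that by (intro eq_matI) (auto simp: select_def inj_on_def)
    moreover have "f k < r" "f k \<noteq> j" "f k \<in> f ` {..<m}" using f j that by auto
    ultimately show ?thesis using M by (simp add: cramer_vec_def)
  qed
  have w_out: "?w $ t = (if t = j then det (select m M g f) else 0)" if "t \<in> {..<r} - f ` {..<m}" for t
    using that M by (auto simp: cramer_vec_def)
  show "M *\<^sub>v ?w = 0\<^sub>v d"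
  proof (rule eq_vecI)
    fix i assume "i < dim_vec (0\<^sub>v d :: 'a vec)"
    then have i: "i < d" by simp
    have "(M *\<^sub>v ?w) $ i = (\<Sum>t\<in>{..<r} - f ` {..<m}. M $$ (i, t) * ?w $ t) + (\<Sum>k<m. M $$ (i, f k) * ?w $ f k)"
      using mult_mat_vec_index_sum[OF M w i] sum_split_image[OF inj f, of "\<lambda>t. M $$ (i, t) * ?w $ t"] by simp
    also have "(\<Sum>t\<in>{..<r} - f ` {..<m}. M $$ (i, t) * ?w $ t)
        = (\<Sum>t\<in>{..<r} - f ` {..<m}. if t = j then M $$ (i, j) * det (select m M g f) else 0)"
      by (intro sum.cong) (auto simp: w_out)
    also have "\<dots> = M $$ (i, j) * det (select m M g f)"
      using j by (subst sum.delta) auto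
    also have "(\<Sum>k<m. M $$ (i, f k) * ?w $ f k) = - (\<Sum>k<m. M $$ (i, f k) * det (select m M g (f(k := j))))"
      by (simp add: w_f sum_negf)
    also have "M $$ (i, j) * det (select m M g f) + \<dots> = 0"
      using column_relation[OF M g f nz van i j(1)] by (simp add: mult.commute)
    finally show "(M *\<^sub>v ?w) $ i = 0\<^sub>v d $ i" using i by simp
  qed (use M in simp)
qed

text \<open>The two sides agree at all columns outside the range of \<open>f\<close>, where the vectors \<open>cramer_vec\<close> look
like multiples of unit vectors. Their difference \<open>y\<close> is a kernel vector supported on the columns
\<open>f k\<close>, which are independent, so it is zero.\<close>

lemma kernel_vec_as_cramer_combination:
  fixes M :: "'a :: field mat"
  assumes M: "M \<in> carrier_mat d r"
    and g: "g ` {..<m} \<subseteq> {..<d}" and f: "f ` {..<m} \<subseteq> {..<r}" and inj: "inj_on f {..<m}"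
    and nz: "det (select m M g f) \<noteq> 0"
    and van: "minors (Suc m) M \<subseteq> {0}"
    and x: "x \<in> mat_kernel M" and t: "t < r"
  shows "det (select m M g f) * x $ t
    = (\<Sum>j\<in>{..<r} - f ` {..<m}. x $ j * cramer_vec m M g f j $ t)"
proof -
  let ?F = "{..<r} - f ` {..<m}" and ?w = "cramer_vec m M g f" and ?D = "det (select m M g f)"
  define y where "y = vec r (\<lambda>t. ?D * x $ t - (\<Sum>j\<in>?F. x $ j * ?w j $ t))"
  have y_out: "y $ t = 0" if "t \<in> ?F" for t
  proof -
    have "(\<Sum>j\<in>?F. x $ j * ?w j $ t) = (\<Sum>j\<in>?F. if t = j then x $ t * ?D else 0)"
      using that M by (intro sum.cong) (auto simp: cramer_vec_def)
    also have "\<dots> = x $ t * ?D" using that by (subst sum.delta') auto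
    finally show ?thesis using that by (simp add: y_def)
  qed
  have kernel_row: "(\<Sum>t<r. M $$ (i, t) * z $ t) = 0" if "z \<in> mat_kernel M" "i < d" for z i
    using mult_mat_vec_index_sum[OF M, of z i] mat_kernelD[OF M that(1)] that(2) by simp
  have My: "(\<Sum>k<m. M $$ (i, f k) * y $ f k) = 0" if i: "i < d" for i
  proof -
    have "(\<Sum>t<r. M $$ (i, t) * y $ t)
        = ?D * (\<Sum>t<r. M $$ (i, t) * x $ t) - (\<Sum>t<r. \<Sum>j\<in>?F. x $ j * (M $$ (i, t) * ?w j $ t))"
      by (simp add: y_def algebra_simps sum_subtractf sum_distrib_left)
    also have "(\<Sum>t<r. \<Sum>j\<in>?F. x $ j * (M $$ (i, t) * ?w j $ t))
        = (\<Sum>j\<in>?F. x $ j * (\<Sum>t<r. M $$ (i, t) * ?w j $ t))"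
      by (subst sum.swap) (simp add: sum_distrib_left)
    also have "\<dots> = 0"
      using cramer_vec_in_kernel[OF M g f inj nz van] kernel_row[OF _ i] by (intro sum.neutral) auto
    finally have "(\<Sum>t<r. M $$ (i, t) * y $ t) = 0" using kernel_row[OF x i] by simp
    then show ?thesis
      using sum_split_image[OF inj f, of "\<lambda>t. M $$ (i, t) * y $ t"] y_out by simp
  qed
  have "select m M g f *\<^sub>v vec m (\<lambda>k. y $ f k) = 0\<^sub>v m"
  proof (rule eq_vecI)
    fix l assume "l < dim_vec (0\<^sub>v m :: 'a vec)"
    then have l: "l < m" by simp
    then have "g l < d" using g by auto
    then show "(select m M g f *\<^sub>v vec m (\<lambda>k. y $ f k)) $ l = 0\<^sub>v m $ l"
      using My l select_mult_vec_index[of "vec m (\<lambda>k. y $ f k)" m l M g f] by simp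
  qed (simp add: select_def)
  then have "vec m (\<lambda>k. y $ f k) = 0\<^sub>v m"
    using nz det_0_iff_vec_prod_zero_field[OF select_carrier[of m M g f]] vec_carrier by blast
  then have "y $ f k = 0" if "k < m" for k using that by (metis index_vec index_zero_vec(1))
  with y_out t have "y $ t = 0" by (cases "t \<in> f ` {..<m}") auto
  then show ?thesis using t by (simp add: y_def)
qed


section \<open>Spanning the kernel by bounded integral vectors\<close>

lemma real_span_subset_kernel:
  assumes "M \<in> carrier_mat d r" "S \<subseteq> mat_kernel M"
  shows "real_span r S \<subseteq> mat_kernel M"
proof -
  interpret kernel d r M using assms by unfold_locales
  show ?thesis using span_same[OF assms(2)] Ker.span_closed assms(2) by auto
qed

lemma bounded_kernel_span_subset_kernel: "bounded_kernel_span B k \<subseteq> mat_kernel B"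
  unfolding bounded_kernel_span_def by (rule real_span_subset_kernel[of B "dim_row B"]) auto

text \<open>The common core of the bound by \<open>max_abs_minor\<close> and of the totally unimodular case. The
hypotheses on \<open>\<mu>\<close> and on the minors of order \<open>m + 1\<close> say that \<open>M\<close> has rank \<open>m\<close>, in the form in
which the Cramer relations need it.\<close>

lemma bounded_kernel_span_eq_kernel:
  fixes M :: "real mat"
  assumes M: "M \<in> carrier_mat d r"
    and \<mu>: "\<mu> \<in> minors m M" "\<mu> \<noteq> 0"
    and van: "minors (Suc m) M \<subseteq> {0}"
    and bound: "\<And>\<nu>. \<nu> \<in> minors m M \<Longrightarrow> \<nu> \<in> \<int> \<and> \<bar>\<nu>\<bar> \<le> real k"
  shows "bounded_kernel_span M (vec r (\<lambda>_. k)) = mat_kernel M"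
proof
  show "bounded_kernel_span M (vec r (\<lambda>_. k)) \<subseteq> mat_kernel M"
    by (rule bounded_kernel_span_subset_kernel)
  obtain g f where g: "g ` {..<m} \<subseteq> {..<d}" and f: "f ` {..<m} \<subseteq> {..<r}"
    and inj: "inj_on f {..<m}" and \<mu>_eq: "\<mu> = det (select m M g f)"
    using minor_as_select[OF \<mu>(1)] M by auto
  have nz: "det (select m M g f) \<noteq> 0" using \<mu> \<mu>_eq by simp
  define S where "S = {z \<in> mat_kernel M. \<forall>t<r. z $ t \<in> \<int> \<and> \<bar>z $ t\<bar> \<le> real k}"
  have span_S: "bounded_kernel_span M (vec r (\<lambda>_. k)) = real_span r S"
  proof -
    have "{z \<in> mat_kernel M. \<forall>t<r. z $ t \<in> \<int> \<and> \<bar>z $ t\<bar> \<le> real (vec r (\<lambda>_. k) $ t)} = S"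
      by (auto simp: S_def)
    then show ?thesis using M by (simp add: bounded_kernel_span_def)
  qed
  have select_bound: "det (select m M g h) \<in> \<int> \<and> \<bar>det (select m M g h)\<bar> \<le> real k"
    if "h ` {..<m} \<subseteq> {..<r}" for h
    using det_select_zero_or_minor[of g m M h] bound[of "det (select m M g h)"] bound[of "- det (select m M g h)"]
      M g that minus_in_Ints_iff by force
  have w_S: "cramer_vec m M g f j \<in> S" if j: "j \<in> {..<r} - f ` {..<m}" for j
  proof -
    have "cramer_vec m M g f j $ t \<in> \<int> \<and> \<bar>cramer_vec m M g f j $ t\<bar> \<le> real k" if "t < r" for t
      using that M j f select_bound[of f] select_bound[of "\<lambda>k. if f k = t then j else f k"]
      by (auto simp: cramer_vec_def image_subset_iff)
    then show ?thesis
      using cramer_vec_in_kernel[OF M g f inj nz van] j by (simp add: S_def)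
  qed
  interpret V: vec_space "TYPE(real)" r .
  have S: "S \<subseteq> carrier_vec r" using mat_kernel_carrier[OF M] by (auto simp: S_def)
  show "mat_kernel M \<subseteq> bounded_kernel_span M (vec r (\<lambda>_. k))"
  proof
    fix x assume x: "x \<in> mat_kernel M"
    define js where "js = filter (\<lambda>j. j \<notin> f ` {..<m}) [0..<r]"
    have js: "set js = {..<r} - f ` {..<m}" "distinct js" by (auto simp: js_def)
    define ws where "ws = map (\<lambda>j. (x $ j / det (select m M g f)) \<cdot>\<^sub>v cramer_vec m M g f j) js"
    have ws_span: "v \<in> V.span S" if v: "v \<in> set ws" for v
    proof -
      obtain j where "j \<in> {..<r} - f ` {..<m}"
        and v_eq: "v = (x $ j / det (select m M g f)) \<cdot>\<^sub>v cramer_vec m M g f j"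
        using v js unfolding ws_def by auto
      then have "cramer_vec m M g f j \<in> V.span S" using w_S V.in_own_span[OF S] by blast
      then show ?thesis unfolding v_eq by (rule V.smult_in_span[OF S])
    qed
    then have in_span: "V.M.sumlist ws \<in> V.span S" by (rule V.sumlist_in_span[OF S])
    have ws_carrier: "v \<in> carrier_vec r" if "v \<in> set ws" for v
      using ws_span[OF that] V.span_closed[OF S] by simp
    have x_ws: "x = V.M.sumlist ws"
    proof (rule eq_vecI)
      show dim: "dim_vec x = dim_vec (V.M.sumlist ws)"
        using mat_kernelD(1)[OF M x] V.sumlist_dim[of ws] ws_carrier by auto
      fix t assume "t < dim_vec (V.M.sumlist ws)"
      then have t: "t < r" using dim mat_kernelD(1)[OF M x] by simp
      have "V.M.sumlist ws $ t = (\<Sum>v\<leftarrow>ws. v $ t)"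
        using ws_carrier t by (intro V.sumlist_vec_index) auto
      also have "\<dots> = (\<Sum>j\<leftarrow>js. x $ j / det (select m M g f) * cramer_vec m M g f j $ t)"
        using t M unfolding ws_def map_map o_def by (simp add: cramer_vec_def)
      also have "\<dots> = (\<Sum>j\<in>{..<r} - f ` {..<m}. x $ j * cramer_vec m M g f j $ t) / det (select m M g f)"
        using js by (simp add: sum_list_distinct_conv_sum_set sum_divide_distrib)
      also have "\<dots> = x $ t"
        using kernel_vec_as_cramer_combination[OF M g f inj nz van x t] nz by (simp add: field_simps)
      finally show "x $ t = V.M.sumlist ws $ t" by simp
    qed
    then show "x \<in> bounded_kernel_span M (vec r (\<lambda>_. k))" using in_span span_S by simp
  qed
qed

section \<open>Existence and size of minors\<close>

lemma minors_of_int: "minors m (map_mat of_int A) = (of_int :: int \<Rightarrow> 'a :: comm_ring_1) ` minors m A"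
proof -
  have sub: "submatrix (map_mat of_int A) I J = map_mat (of_int :: int \<Rightarrow> 'a) (submatrix A I J)" for I J
    by (intro eq_matI) (auto simp: submatrix_def pick_le)
  show ?thesis
    unfolding minors_def sub of_int_hom.hom_det by auto
qed

lemma finite_minors: "finite (minors m A)"
proof -
  have "minors m A \<subseteq> (\<lambda>(I, J). det (submatrix A I J)) ` (Pow {..<dim_row A} \<times> Pow {..<dim_col A})"
    unfolding minors_def by auto
  then show ?thesis by (rule finite_subset) auto
qed

lemma minors_above_dim_row:
  assumes "dim_row A < m"
  shows "minors m A = {}"
proof -
  have "card I \<noteq> m" if "I \<subseteq> {..<dim_row A}" for I
    using card_mono[OF _ that] assms by auto
  then show ?thesis unfolding minors_def by blast
qed

lemma minors_0: "minors 0 A = {1}"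
proof -
  have "I = {}" if "I \<subseteq> {..<n::nat}" "card I = 0" for I n
    using that finite_subset[of I "{..<n}"] by auto
  then have "minors 0 A = {det (submatrix A {} {})}"
    unfolding minors_def by (intro equalityI subsetI) (blast, auto intro!: exI[of _ "{}"])
  also have "det (submatrix A {} {}) = 1" by (simp add: submatrix_def det_def)
  finally show ?thesis .
qed

text \<open>A maximal independent set of columns has \<open>s\<close> elements; writing them side by side gives a square
matrix of full rank.\<close>

lemma full_rank_nonzero_minor:
  fixes A :: "'a :: field mat"
  assumes A: "A \<in> carrier_mat s r" and rank: "vec_space.rank s A = s"
  obtains \<mu> where "\<mu> \<in> minors s A" "\<mu> \<noteq> 0"
proof -
  interpret V: vec_space "TYPE('a)" s .
  have cols: "set (cols A) \<subseteq> carrier_vec s" using A cols_dim by blast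
  obtain S where S: "maximal S (\<lambda>T. T \<subseteq> set (cols A) \<and> V.lin_indpt T)"
    using maximal_exists[of "\<lambda>T. T \<subseteq> set (cols A) \<and> V.lin_indpt T" "card (set (cols A))" "{}"]
    by (meson List.finite_set card_mono empty_iff empty_subsetI V.finite_lin_indpt2 rev_finite_subset)
  then have S_sub: "S \<subseteq> set (cols A)" and li: "V.lin_indpt S"
    unfolding maximal_def by auto
  have "card S = s" using V.rank_card_indpt[OF A S] rank by simp
  then obtain xs where xs: "set xs = S" "distinct xs" "length xs = s"
    using S_sub by (metis List.finite_set distinct_card finite_distinct_list finite_subset)
  have "\<forall>i<s. \<exists>j<r. xs ! i = col A j"
  proof (intro allI impI)
    fix i assume "i < s"
    then have "xs ! i \<in> set (cols A)" using xs S_sub nth_mem by blast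
    then show "\<exists>j<r. xs ! i = col A j" using A by (auto simp: cols_def)
  qed
  then obtain f where f: "\<And>i. i < s \<Longrightarrow> f i < r \<and> xs ! i = col A (f i)" by metis
  have cols_select: "cols (select s A id f) = xs"
  proof (rule nth_equalityI)
    fix i assume "i < length (cols (select s A id f))"
    then have "i < s" by (simp add: select_def)
    then show "cols (select s A id f) ! i = xs ! i"
      using f[of i] A by (intro eq_vecI) (auto simp: select_def)
  qed (simp add: select_def xs)
  have "det (select s A id f) \<noteq> 0"
    using V.lin_indpt_full_rank[OF select_carrier] V.det_rank_iff[OF select_carrier] cols_select xs li
    by metis
  moreover have "det (select s A id f) = 0 \<or> det (select s A id f) \<in> minors s A
      \<or> - det (select s A id f) \<in> minors s A"
    using f A by (intro det_select_zero_or_minor) auto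
  ultimately show thesis
    using that[of "det (select s A id f)"] that[of "- det (select s A id f)"] by auto
qed

section \<open>Bounds on the replication threshold\<close>

lemma replication_threshold_le:
  assumes "0 < k" "bounded_kernel_span B (vec (dim_col B) (\<lambda>_. k)) = mat_kernel B"
  shows "replication_threshold B \<le> k"
  unfolding replication_threshold_def using assms by (intro Least_le) simp

lemma replication_threshold_eq_1:
  assumes "bounded_kernel_span B (vec (dim_col B) (\<lambda>_. 1)) = mat_kernel B"
  shows "replication_threshold B = 1"
  unfolding replication_threshold_def using assms by (intro Least_equality) auto

lemma replication_threshold_le_max_abs_minor:
  assumes A: "A \<in> carrier_mat s r" and full: "full_row_rank A"
    and ker: "mat_kernel (map_mat real_of_int A) = mat_kernel B" and B: "dim_col B = r"
  shows "int (replication_threshold B) \<le> max_abs_minor A"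
proof -
  let ?M = "map_mat real_of_int A"
  have M: "?M \<in> carrier_mat s r" using A by simp
  have "vec_space.rank s ?M = s" using full A by (auto simp: full_row_rank_def)
  from full_rank_nonzero_minor[OF M this]
  obtain \<mu> where \<mu>: "\<mu> \<in> minors s ?M" "\<mu> \<noteq> 0" .
  have le_max: "\<bar>\<nu>\<bar> \<le> max_abs_minor A" if "\<nu> \<in> minors s A" for \<nu>
    unfolding max_abs_minor_def using that A finite_minors[of s A] by (intro Max_ge) auto
  obtain \<nu> where \<nu>: "\<nu> \<in> minors s A" "\<mu> = real_of_int \<nu>"
    using \<mu>(1) unfolding minors_of_int by blast
  then have pos: "0 < max_abs_minor A" using le_max[of \<nu>] \<mu>(2) by auto
  define k where "k = nat (max_abs_minor A)"
  have "bounded_kernel_span ?M (vec r (\<lambda>_. k)) = mat_kernel ?M"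
  proof (rule bounded_kernel_span_eq_kernel[OF M \<mu>])
    show "minors (Suc s) ?M \<subseteq> {0}" using minors_above_dim_row[of ?M "Suc s"] A by auto
    fix \<nu> assume "\<nu> \<in> minors s ?M"
    then obtain n where n: "n \<in> minors s A" "\<nu> = real_of_int n" unfolding minors_of_int by blast
    then have "\<bar>real_of_int n\<bar> \<le> real_of_int (max_abs_minor A)"
      using le_max[of n] by (metis of_int_abs of_int_le_iff)
    then show "\<nu> \<in> \<int> \<and> \<bar>\<nu>\<bar> \<le> real k" using n pos by (simp add: k_def)
  qed
  then have "bounded_kernel_span B (vec (dim_col B) (\<lambda>_. k)) = mat_kernel B"
    using A B ker by (simp add: bounded_kernel_span_def)
  then have "replication_threshold B \<le> k"
    using pos by (intro replication_threshold_le) (auto simp: k_def)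
  then show ?thesis using pos by (simp add: k_def)
qed

lemma replication_threshold_trivial_kernel:
  assumes B: "B \<in> carrier_mat d r" and ker: "mat_kernel B = {0\<^sub>v r} \<or> mat_kernel B = carrier_vec r"
  shows "replication_threshold B = 1"
proof (rule replication_threshold_eq_1, rule antisym[OF bounded_kernel_span_subset_kernel])
  interpret V: vec_space "TYPE(real)" r .
  let ?S = "{z \<in> mat_kernel B. \<forall>t<r. z $ t \<in> \<int> \<and> \<bar>z $ t\<bar> \<le> 1}"
  have S: "?S \<subseteq> carrier_vec r" using mat_kernel_carrier[OF B] by auto
  have span_S: "bounded_kernel_span B (vec (dim_col B) (\<lambda>_. 1)) = V.span ?S"
    using B by (simp add: bounded_kernel_span_def cong: conj_cong)
  show "mat_kernel B \<subseteq> bounded_kernel_span B (vec (dim_col B) (\<lambda>_. 1))"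
    using ker
  proof
    assume 0: "mat_kernel B = {0\<^sub>v r}"
    have "0\<^sub>v r \<in> ?S" unfolding 0 by simp
    then have "0\<^sub>v r \<in> V.span ?S" using V.in_own_span[OF S] by blast
    then show ?thesis using 0 span_S by simp
  next
    assume full: "mat_kernel B = carrier_vec r"
    have "set (unit_vecs r) \<subseteq> ?S" unfolding full by (auto simp: unit_vecs_def unit_vec_def)
    then have "V.span (set (unit_vecs r)) \<subseteq> V.span ?S" by (rule V.span_is_monotone)
    then show ?thesis using full span_S V.span_unit_vecs_is_carrier by simp
  qed
qed

lemma replication_threshold_totally_unimodular:
  assumes tu: "totally_unimodular B"
  shows "replication_threshold B = 1"
proof (rule replication_threshold_eq_1)
  let ?P = "\<lambda>m. \<not> minors m B \<subseteq> {0}"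
  have bounded: "m \<le> dim_row B" if "?P m" for m
    using that minors_above_dim_row[of B m] by (cases "dim_row B < m") auto
  \<comment> \<open>The largest order of a nonzero minor exists because the empty minor is \<open>1\<close>.\<close>
  define m where "m = (GREATEST m. ?P m)"
  have "?P 0" by (simp add: minors_0)
  then have "?P m" unfolding m_def using bounded by (rule GreatestI_nat)
  then obtain \<mu> where \<mu>: "\<mu> \<in> minors m B" "\<mu> \<noteq> 0" by auto
  have "minors (Suc m) B \<subseteq> {0}"
    using Greatest_le_nat[of ?P "Suc m" "dim_row B"] bounded unfolding m_def by fastforce
  moreover have "\<nu> \<in> \<int> \<and> \<bar>\<nu>\<bar> \<le> real 1" if "\<nu> \<in> minors m B" for \<nu>
    using tu that unfolding totally_unimodular_def by fastforce
  ultimately show "bounded_kernel_span B (vec (dim_col B) (\<lambda>_. 1)) = mat_kernel B"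
    using bounded_kernel_span_eq_kernel[OF _ \<mu>, of "dim_row B" "dim_col B" 1] by simp
qed

theorem proposition3p11:
  fixes B :: "real mat" and d r :: nat
  assumes "B \<in> carrier_mat d r"
  shows "(\<forall>s (A :: int mat).
            A \<in> carrier_mat s r \<and> full_row_rank A \<and>
            mat_kernel (map_mat real_of_int A) = mat_kernel B \<and> 0 < s \<and> s < r
            \<longrightarrow> int (replication_threshold B) \<le> max_abs_minor A)
       \<and> (mat_kernel B = {0\<^sub>v r} \<or> mat_kernel B = carrier_vec r
            \<longrightarrow> replication_threshold B = 1)
       \<and> (totally_unimodular B \<longrightarrow> replication_threshold B = 1)"
proof (intro conjI allI impI)
  fix s and A :: "int mat"
  assume A: "A \<in> carrier_mat s r \<and> full_row_rank A \<and>
    mat_kernel (map_mat real_of_int A) = mat_kernel B \<and> 0 < s \<and> s < r"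
  have "dim_col B = r" using assms by simp
  with A show "int (replication_threshold B) \<le> max_abs_minor A"
    by (elim conjE) (rule replication_threshold_le_max_abs_minor)
next
  assume "mat_kernel B = {0\<^sub>v r} \<or> mat_kernel B = carrier_vec r"
  then show "replication_threshold B = 1"
    by (rule replication_threshold_trivial_kernel[OF assms])
next
  assume "totally_unimodular B"
  then show "replication_threshold B = 1"
    by (rule replication_threshold_totally_unimodular)
qed

end
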